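(* Let $m$ be a positive integer, $p_{1},\dots,p_{m}\in[1,\infty]$ and $q_{1},\dots,q_{m}\in(0,\infty]$. Then, for any bijection $\sigma:\{1,\dots,m\}\rightarrow\{1,\dots,m\}$, the inequality \[ \left(\sum_{j_{\sigma(1)}=1}^{\infty}\left(\sum_{j_{\sigma(2)}=1}^{\infty}\cdots\left(\sum_{j_{\sigma(m)}=1}^{\infty}A(e_{j_{1}},\dots,e_{j_{m}})^{q_{m}}\right)^{\frac{q_{m-1}}{q_{m}}}\cdots\right)^{\frac{q_{1}}{q_{2}}}\right)^{\frac{1}{q_{1}}}\leq\|A\| \] holds for all bounded non-negative $m$-linear forms $A:X_{p_{1}}\times\cdots\times X_{p_{m}}\rightarrow\mathbb{K}$ if, and only if, \[ q_{1}\geq\delta^{p_{\sigma(1)},\dots,p_{\sigma(m)}},\quad q_{2}\geq\delta^{p_{\sigma(2)},\dots,p_{\sigma(m)}},\quad\dots,\quad q_{m-1}\geq\delta^{p_{\sigma(m-1)},p_{\sigma(m)}},\quad q_{m}\geq\delta^{p_{\sigma(m)}}, \] that is, $q_k\ge \delta^{p_{\sigma(k)},\dots,p_{\sigma(m)}}$ for every $k=1,\dots,m$.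
   Context: $\mathbb{K}$ denotes $\mathbb{R}$ or $\mathbb{C}$. $X_{p}:=\ell_{p}$ (scalar sequences over $\mathbb{K}$, with the usual norm) for $1\leq p<\infty$, and $X_{\infty}:=c_{0}$ (with the sup norm). $(e_j)_{j\ge1}$ are the canonical unit vectors. Convention: $1/\infty:=0$. An $m$-linear form $A:X_{p_1}\times\cdots\times X_{p_m}\to\mathbb{K}$ is bounded if $\|A\|:=\sup\{|A(x^{(1)},\dots,x^{(m)})| : \|x^{(i)}\|_{X_{p_i}}\leq1,\ 1\le i\le m\}<\infty$. It is non-negative if $A(e_{j_1},\dots,e_{j_m})\geq0$ (a non-negative real number) for all $(j_1,\dots,j_m)\in\mathbb{N}^m$. For $s_k,\dots,s_m\in[1,\infty]$ define \[ \delta^{s_{k},\dots,s_{m}}:=\frac{1}{1-\left(\frac{1}{s_{k}}+\cdots+\frac{1}{s_{m}}\right)}\quad\text{if }\frac{1}{s_k}+\cdots+\frac{1}{s_m}<1, \] and $\delta^{s_{k},\dots,s_{m}}:=\infty$ if $\frac{1}{s_k}+\cdots+\frac{1}{s_m}\geq1$. When $q=\infty$, the notation $\left(\sum_j|x_j|^{q}\right)^{1/q}$ means $\sup_j|x_j|$. The left-hand side of the inequality is thus the iterated mixed norm obtained by taking first the $\ell_{q_m}$ (quasi-)norm in the index $j_{\sigma(m)}$, then the $\ell_{q_{m-1}}$ (quasi-)norm in $j_{\sigma(m-1)}$, and so on, ending with the $\ell_{q_1}$ (quasi-)norm in $j_{\sigma(1)}$, each being a supremum when the corresponding exponent is $\infty$.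 *)

theory Defs
  imports "HOL-Analysis.Analysis"
begin

text \<open>
  Exponents range over \<^typ>\<open>ennreal\<close>, where \<open>1 / \<infinity> = 0\<close>. Norms take values in \<^typ>\<open>ennreal\<close>, so that
  divergent sums and unbounded suprema are \<open>\<infinity>\<close>. Sequences are indexed from \<open>0\<close>; the slots of
  an \<open>m\<close>-linear form are indexed by \<open>{1..m}\<close>.
\<close>

text \<open>Only used with exponents \<open>r > 0\<close>.\<close>

definition ennreal_powr :: "ennreal \<Rightarrow> real \<Rightarrow> ennreal" where
  "ennreal_powr a r = (if a = \<infinity> then \<infinity> else ennreal (enn2real a powr r))"

definition lq_norm :: "ennreal \<Rightarrow> (nat \<Rightarrow> ennreal) \<Rightarrow> ennreal" where
  "lq_norm q a =
     (if q = \<infinity> then (SUP j. a j)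
      else ennreal_powr (\<Sum>j. ennreal_powr (a j) (enn2real q)) (1 / enn2real q))"

definition X_norm :: "ennreal \<Rightarrow> (nat \<Rightarrow> 'k::real_normed_field) \<Rightarrow> ennreal" where
  "X_norm p x = lq_norm p (\<lambda>j. ennreal (norm (x j)))"

text \<open>\<open>\<ell>\<^sub>p\<close> for \<open>p < \<infinity>\<close>, and \<open>c\<^sub>0\<close> (not \<open>\<ell>\<^sub>\<infinity>\<close>) for \<open>p = \<infinity>\<close>.\<close>

definition X_space :: "ennreal \<Rightarrow> (nat \<Rightarrow> 'k::real_normed_field) set" where
  "X_space p = (if p = \<infinity> then {x. x \<longlonglongrightarrow> 0} else {x. X_norm p x < \<infinity>})"

definition unit_seq :: "nat \<Rightarrow> nat \<Rightarrow> 'k::real_normed_field" where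
  "unit_seq j = (\<lambda>n. if n = j then 1 else 0)"

text \<open>
  An \<open>m\<close>-tuple \<open>(x\<^sub>1, \<dots>, x\<^sub>m)\<close> is an element of the extensional product over \<open>{1..m}\<close>; the value of a
  form outside this product is irrelevant.
\<close>

definition X_prod :: "nat \<Rightarrow> (nat \<Rightarrow> ennreal) \<Rightarrow> (nat \<Rightarrow> nat \<Rightarrow> 'k::real_normed_field) set" where
  "X_prod m p = (\<Pi>\<^sub>E i\<in>{1..m}. X_space (p i))"

definition multilinear_form ::
  "nat \<Rightarrow> (nat \<Rightarrow> ennreal) \<Rightarrow> ((nat \<Rightarrow> nat \<Rightarrow> 'k::real_normed_field) \<Rightarrow> 'k) \<Rightarrow> bool" where
  "multilinear_form m p A \<longleftrightarrow>
     (\<forall>x\<in>X_prod m p. \<forall>i\<in>{1..m}. \<forall>u\<in>X_space (p i).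
        (\<forall>v\<in>X_space (p i). A (x(i := \<lambda>n. u n + v n)) = A (x(i := u)) + A (x(i := v))) \<and>
        (\<forall>c. A (x(i := \<lambda>n. c * u n)) = c * A (x(i := u))))"

definition form_norm ::
  "nat \<Rightarrow> (nat \<Rightarrow> ennreal) \<Rightarrow> ((nat \<Rightarrow> nat \<Rightarrow> 'k::real_normed_field) \<Rightarrow> 'k) \<Rightarrow> ennreal" where
  "form_norm m p A =
     (SUP x\<in>{x \<in> X_prod m p. \<forall>i\<in>{1..m}. X_norm (p i) (x i) \<le> 1}. ennreal (norm (A x)))"

definition bounded_multilinear_form ::
  "nat \<Rightarrow> (nat \<Rightarrow> ennreal) \<Rightarrow> ((nat \<Rightarrow> nat \<Rightarrow> 'k::real_normed_field) \<Rightarrow> 'k) \<Rightarrow> bool" where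
  "bounded_multilinear_form m p A \<longleftrightarrow> multilinear_form m p A \<and> form_norm m p A < \<infinity>"

definition form_coeff ::
  "nat \<Rightarrow> ((nat \<Rightarrow> nat \<Rightarrow> 'k::real_normed_field) \<Rightarrow> 'k) \<Rightarrow> (nat \<Rightarrow> nat) \<Rightarrow> 'k" where
  "form_coeff m A j = A (\<lambda>i\<in>{1..m}. unit_seq (j i))"

definition nonneg_form ::
  "nat \<Rightarrow> ((nat \<Rightarrow> nat \<Rightarrow> 'k::real_normed_field) \<Rightarrow> 'k) \<Rightarrow> bool" where
  "nonneg_form m A \<longleftrightarrow> (\<forall>j. form_coeff m A j \<in> \<real>\<^sub>\<ge>\<^sub>0)"

text \<open>
  A pair \<open>(i, q)\<close> in the list stands for the \<open>\<ell>\<^sub>q\<close> norm in the index \<open>j\<^sub>i\<close>; the head of the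
  list is the outermost norm.
\<close>

fun mixed_norm :: "(nat \<times> ennreal) list \<Rightarrow> ((nat \<Rightarrow> nat) \<Rightarrow> ennreal) \<Rightarrow> (nat \<Rightarrow> nat) \<Rightarrow> ennreal" where
  "mixed_norm [] a j = a j"
| "mixed_norm ((i, q) # l) a j = lq_norm q (\<lambda>n. mixed_norm l a (j(i := n)))"

text \<open>
  The iterated norm of the coefficients \<open>A(e\<^bsub>j(1)\<^esub>, \<dots>, e\<^bsub>j(m)\<^esub>)\<close>, with \<open>q\<^sub>k\<close> applied to the index
  \<open>j\<^bsub>\<sigma>(k)\<^esub>\<close>. For non-negative forms \<open>norm\<close> only serves to view a coefficient as an extended
  non-negative real. All indices \<open>j\<^sub>1, \<dots>, j\<^sub>m\<close> are overwritten, so the initial multi-index \<open>\<lambda>_. 0\<close>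
  is immaterial.
\<close>

definition form_mixed_norm ::
  "nat \<Rightarrow> (nat \<Rightarrow> ennreal) \<Rightarrow> (nat \<Rightarrow> nat) \<Rightarrow>
     ((nat \<Rightarrow> nat \<Rightarrow> 'k::real_normed_field) \<Rightarrow> 'k) \<Rightarrow> ennreal" where
  "form_mixed_norm m q \<sigma> A =
     mixed_norm (map (\<lambda>k. (\<sigma> k, q k)) [1..<Suc m]) (\<lambda>j. ennreal (norm (form_coeff m A j))) (\<lambda>_. 0)"

definition delta :: "(nat \<Rightarrow> ennreal) \<Rightarrow> nat \<Rightarrow> nat \<Rightarrow> ennreal" where
  "delta s k m =
     (if (\<Sum>i=k..m. 1 / s i) < 1 then 1 / (1 - (\<Sum>i=k..m. 1 / s i)) else \<infinity>)"

end

theory Submission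
  imports Defs
begin

text \<open>
  Both implications hold over every real normed field, so one argument serves \<open>\<real>\<close> and \<open>\<complex>\<close>.
  Write \<open>r\<^sub>i = 1 / p\<^sub>i\<close> and, for a position \<open>k\<close>, let \<open>s = r\<^bsub>\<sigma>(k)\<^esub> + \<dots> + r\<^bsub>\<sigma>(m)\<^esub>\<close>, so that \<open>\<delta>\<close> is the
  exponent \<open>1 / (1 - s)\<close>, or \<open>\<infinity>\<close> if \<open>s \<ge> 1\<close>.

  Sufficiency. Since \<open>\<ell>\<^sub>q\<close> norms decrease in \<open>q\<close>, it is enough to treat exponents \<open>\<delta>\<close>. By induction on
  the number of norms, from the innermost one outwards, every number below the mixed norm of a
  non-negative array is reached by pairing the array with finitely supported non-negative test vectors
  \<open>x\<^sub>i\<close> in the unit balls (\<open>mixed_norm_attained\<close>). In the induction step the outermost index \<open>n\<close> runs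
  over a finite set, and for each \<open>n\<close> there are test vectors \<open>y\<^bsub>n,i\<^esub>\<close> that almost attain the inner norm
  \<open>b\<^sub>n\<close>. Given weights \<open>\<theta>\<^sub>n > 0\<close> with \<open>\<Sum>\<theta>\<^sub>n \<le> 1\<close>, the vectors \<open>z\<^sub>i = (\<Sum>\<^sub>n \<theta>\<^sub>n y\<^bsub>n,i\<^esub>\<^bsup>p\<^esup>)\<^bsup>1/p\<^esup>\<close> with
  \<open>p = p\<^sub>i\<close> stay in the unit balls and dominate \<open>\<theta>\<^sub>n\<close> to the power \<open>r\<^sub>i\<close> times \<open>y\<^bsub>n,i\<^esub>\<close>
  (\<open>unit_ball_combine\<close>). So the pairing with \<open>z\<close> is, up to the approximation, at least
  \<open>\<Sum>\<^sub>n \<theta>\<^sub>n\<^bsup>s\<^esup> b\<^sub>n\<close>, and the supremum of this over \<open>\<theta>\<close> is the \<open>\<ell>\<^sub>\<delta>\<close> norm of \<open>b\<close>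
  (\<open>lq_norm_dual_approx\<close>). A multilinear form evaluated at finitely supported vectors is the pairing with its
  coefficients (\<open>form_eq_pairing\<close>).

  Necessity. For a fixed \<open>k\<close>, test the inequality on the form that evaluates the slots
  \<open>\<sigma>(1), \<dots>, \<sigma>(k-1)\<close> at the coordinate \<open>0\<close> and is the diagonal form of length \<open>2\<close> in the others. Its mixed
  norm is at least \<open>2\<^bsup>1/q\<^esup>\<close> with \<open>q = q\<^sub>k\<close>, and by a Hoelder inequality (\<open>sum_prod_le_card_powr\<close>) its norm
  is at most \<open>2\<^bsup>1-s\<^esup>\<close>, or \<open>1\<close> if \<open>s \<ge> 1\<close>. Comparing the two gives \<open>q\<^sub>k \<ge> \<delta>\<close> (\<open>delta_le_of_diagonal_form\<close>).
\<close>

section \<open>A Hoelder inequality for unit balls\<close>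

text \<open>
  The weight missing from \<open>1\<close> is put on the number \<open>1\<close>. With \<open>G\<close> denoting the right-hand side, the tangent
  inequality \<open>ln (t / G) \<le> t / G - 1\<close>, summed with these weights, has right-hand side \<open>0\<close>.
\<close>

lemma weighted_am_gm:
  fixes w t :: "'i \<Rightarrow> real"
  assumes "finite I" and w: "\<And>i. i \<in> I \<Longrightarrow> 0 \<le> w i" and t: "\<And>i. i \<in> I \<Longrightarrow> 0 \<le> t i"
    and s: "sum w I \<le> 1"
  shows "(\<Prod>i\<in>I. t i powr w i) \<le> (\<Sum>i\<in>I. w i * t i) + (1 - sum w I)"
proof (cases "\<exists>i\<in>I. t i = 0")
  case True
  then have "(\<Prod>i\<in>I. t i powr w i) = 0"
    using \<open>finite I\<close> by auto
  moreover have "0 \<le> (\<Sum>i\<in>I. w i * t i)"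
    by (intro sum_nonneg mult_nonneg_nonneg w t)
  ultimately show ?thesis using s by simp
next
  case False
  then have t: "\<And>i. i \<in> I \<Longrightarrow> 0 < t i" using t by force
  define G where "G = (\<Sum>i\<in>I. w i * t i) + (1 - sum w I)"
  have nn: "0 \<le> (\<Sum>i\<in>I. w i * t i)"
    by (intro sum_nonneg mult_nonneg_nonneg w less_imp_le[OF t])
  have G: "0 < G"
  proof (cases "sum w I = 0")
    case True then show ?thesis using nn by (simp add: G_def)
  next
    case False
    then obtain i where i: "i \<in> I" "w i \<noteq> 0" by (meson sum.neutral)
    have "0 < (\<Sum>i\<in>I. w i * t i)"
      by (rule sum_pos2[OF \<open>finite I\<close> i(1)])
        (use i w t in \<open>auto intro!: mult_pos_pos mult_nonneg_nonneg simp: less_le\<close>)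
    then show ?thesis using s by (simp add: G_def)
  qed
  have "(\<Sum>i\<in>I. w i * ln (t i / G)) + (1 - sum w I) * ln (1 / G)
      \<le> (\<Sum>i\<in>I. w i * (t i / G - 1)) + (1 - sum w I) * (1 / G - 1)"
    using t G s w
    by (intro add_mono sum_mono mult_left_mono ln_le_minus_one) auto
  also have "(\<Sum>i\<in>I. w i * (t i / G - 1)) = (\<Sum>i\<in>I. w i * t i) / G - sum w I"
    by (simp add: right_diff_distrib sum_subtractf sum_divide_distrib)
  also have "(\<Sum>i\<in>I. w i * t i) / G - sum w I + (1 - sum w I) * (1 / G - 1)
      = ((\<Sum>i\<in>I. w i * t i) + (1 - sum w I)) / G - 1"
    by (simp add: algebra_simps add_divide_distrib diff_divide_distrib)
  also have "\<dots> = G / G - 1" by (simp only: G_def)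
  also have "\<dots> = 0" using G by simp
  finally have "(\<Sum>i\<in>I. w i * ln (t i / G)) + (1 - sum w I) * ln (1 / G) \<le> 0" .
  moreover have "(\<Sum>i\<in>I. w i * ln (t i / G)) = (\<Sum>i\<in>I. w i * ln (t i)) - sum w I * ln G"
    unfolding sum_distrib_right sum_subtractf[symmetric]
  proof (rule sum.cong)
    fix i assume "i \<in> I"
    then show "w i * ln (t i / G) = w i * ln (t i) - w i * ln G"
      using t[of i] G by (simp add: ln_div right_diff_distrib)
  qed simp
  moreover have "ln (1 / G) = - ln G" using G by (simp add: ln_div)
  ultimately have le: "(\<Sum>i\<in>I. w i * ln (t i)) \<le> ln G" by (simp add: algebra_simps)
  have "(\<Prod>i\<in>I. t i powr w i) = exp (\<Sum>i\<in>I. w i * ln (t i))"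
    unfolding exp_sum[OF \<open>finite I\<close>] 
    by (rule prod.cong) (use less_imp_neq[OF t] in \<open>auto simp: powr_def\<close>)
  also have "\<dots> \<le> G" using le G by (simp add: ln_ge_iff)
  finally show ?thesis by (simp add: G_def)
qed

text \<open>
  Hoelder's inequality for several factors from unit balls, \<open>r i\<close> being the reciprocal of the exponent. If
  the reciprocals sum to at most \<open>1\<close>, it is the weighted AM-GM inequality applied, for each \<open>n\<close>, to the
  numbers \<open>card K\<close> times \<open>u i n\<close> to the power \<open>1 / r i\<close>, and summed over \<open>n\<close>. If they sum to \<open>S > 1\<close>,
  entries \<open>u i n \<le> 1\<close> allow to replace every \<open>r i\<close> by \<open>r i / S\<close>.
\<close>

lemma sum_prod_le_card_powr:
  fixes r :: "'i \<Rightarrow> real" and u :: "'i \<Rightarrow> 'n \<Rightarrow> real"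
  assumes "finite I" "finite K" "K \<noteq> {}"
    and r: "\<And>i. i \<in> I \<Longrightarrow> 0 \<le> r i"
    and u: "\<And>i n. i \<in> I \<Longrightarrow> n \<in> K \<Longrightarrow> 0 \<le> u i n \<and> u i n \<le> 1"
    and ball: "\<And>i. i \<in> I \<Longrightarrow> 0 < r i \<Longrightarrow> (\<Sum>n\<in>K. u i n powr (1 / r i)) \<le> 1"
  shows "(\<Sum>n\<in>K. \<Prod>i\<in>I. u i n) \<le> card K powr (max 0 (1 - sum r I))"
proof -
  have main: "(\<Sum>n\<in>K. \<Prod>i\<in>I. u i n) \<le> card K powr (1 - sum r' I)"
    if r': "\<And>i. i \<in> I \<Longrightarrow> 0 \<le> r' i" and s: "sum r' I \<le> 1"
      and ball': "\<And>i. i \<in> I \<Longrightarrow> 0 < r' i \<Longrightarrow> (\<Sum>n\<in>K. u i n powr (1 / r' i)) \<le> 1"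
    for r' :: "'i \<Rightarrow> real"
  proof -
    let ?N = "real (card K)"
    have N: "?N > 0" using assms by (simp add: card_gt_0_iff)
    \<comment> \<open>An exponent \<open>\<infinity>\<close>, that is \<open>r\' i = 0\<close>, only says \<open>u i n \<le> 1\<close>; then \<open>t i n = 1\<close> makes the AM-GM factor equal to \<open>1\<close>.\<close>
    define t where "t i n = (if r' i = 0 then 1 else ?N * u i n powr (1 / r' i))" for i n
    have "?N powr sum r' I * (\<Prod>i\<in>I. u i n) \<le> (\<Sum>i\<in>I. r' i * t i n) + (1 - sum r' I)"
      if n: "n \<in> K" for n
    proof -
      have "?N powr sum r' I * (\<Prod>i\<in>I. u i n) = (\<Prod>i\<in>I. ?N powr r' i * u i n)"
        using N by (simp add: powr_sum prod.distrib)
      also have "\<dots> \<le> (\<Prod>i\<in>I. t i n powr r' i)"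
      proof (rule prod_mono)
        fix i assume i: "i \<in> I"
        show "0 \<le> ?N powr r' i * u i n \<and> ?N powr r' i * u i n \<le> t i n powr r' i"
          using u[OF i n] N by (auto simp: t_def powr_mult powr_powr)
      qed
      also have "\<dots> \<le> (\<Sum>i\<in>I. r' i * t i n) + (1 - sum r' I)"
        by (rule weighted_am_gm) (use assms r' s in \<open>auto simp: t_def\<close>)
      finally show ?thesis .
    qed
    then have "(\<Sum>n\<in>K. ?N powr sum r' I * (\<Prod>i\<in>I. u i n))
        \<le> (\<Sum>n\<in>K. (\<Sum>i\<in>I. r' i * t i n) + (1 - sum r' I))"
      by (rule sum_mono)
    also have "\<dots> = (\<Sum>i\<in>I. r' i * (\<Sum>n\<in>K. t i n)) + ?N * (1 - sum r' I)"
      by (simp add: sum.distrib sum_distrib_left sum.swap[of _ I K])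
    also have "\<dots> \<le> (\<Sum>i\<in>I. r' i * ?N) + ?N * (1 - sum r' I)"
    proof (intro add_right_mono sum_mono)
      fix i assume i: "i \<in> I"
      show "r' i * (\<Sum>n\<in>K. t i n) \<le> r' i * ?N"
      proof (cases "r' i = 0")
        case False
        then have "(\<Sum>n\<in>K. t i n) = ?N * (\<Sum>n\<in>K. u i n powr (1 / r' i))"
          by (simp add: t_def sum_distrib_left)
        also have "\<dots> \<le> ?N * 1"
          using ball'[OF i] r'[OF i] False by (intro mult_left_mono) auto
        finally show ?thesis using r'[OF i] by (intro mult_left_mono) auto
      qed simp
    qed
    also have "\<dots> = ?N" by (simp add: sum_distrib_right[symmetric] algebra_simps)
    finally have "?N powr sum r' I * (\<Sum>n\<in>K. \<Prod>i\<in>I. u i n) \<le> ?N"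
      by (simp add: sum_distrib_left)
    then show ?thesis
      using N by (simp add: powr_diff field_simps)
  qed
  show ?thesis
  proof (cases "sum r I \<le> 1")
    case True
    then show ?thesis using main[of r] r ball by simp
  next
    case False
    let ?s = "sum r I"
    have "(\<Sum>n\<in>K. \<Prod>i\<in>I. u i n) \<le> card K powr (1 - (\<Sum>i\<in>I. r i / ?s))"
    proof (rule main)
      fix i assume i: "i \<in> I" "0 < r i / ?s"
      then have ri: "0 < r i" using False by (simp add: zero_less_divide_iff)
      have "(\<Sum>n\<in>K. u i n powr (1 / (r i / ?s))) \<le> (\<Sum>n\<in>K. u i n powr (1 / r i))"
        using u[OF i(1)] ri False by (intro sum_mono powr_mono') (auto simp: divide_right_mono)
      then show "(\<Sum>n\<in>K. u i n powr (1 / (r i / ?s))) \<le> 1"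
        using ball[OF i(1) ri] by simp
    qed (use r False in \<open>auto simp: sum_divide_distrib[symmetric]\<close>)
    then show ?thesis using False by (simp add: sum_divide_distrib[symmetric])
  qed
qed

section \<open>Sequence norms and their unit balls\<close>

lemma ennreal_powr_ennreal [simp]: "0 \<le> x \<Longrightarrow> ennreal_powr (ennreal x) r = ennreal (x powr r)"
  by (simp add: ennreal_powr_def)

lemma ennreal_powr_top [simp]: "ennreal_powr \<infinity> r = \<infinity>" "ennreal_powr top r = top"
  by (simp_all add: ennreal_powr_def)

lemma ennreal_powr_mono: "0 \<le> r \<Longrightarrow> a \<le> b \<Longrightarrow> ennreal_powr a r \<le> ennreal_powr b r"
  by (cases a; cases b) (auto simp: top_unique intro!: ennreal_leI powr_mono2)

lemma ennreal_powr_inverse: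
  assumes "0 < r"
  shows "ennreal_powr (ennreal_powr a r) (1 / r) = a" "ennreal_powr (ennreal_powr a (1 / r)) r = a"
  using assms by (cases a; simp add: powr_powr)+

lemma ennreal_powr_le_iff:
  assumes "0 < r"
  shows "ennreal_powr a (1 / r) \<le> b \<longleftrightarrow> a \<le> ennreal_powr b r"
  by (metis assms ennreal_powr_inverse ennreal_powr_mono less_eq_real_def zero_less_divide_1_iff)

lemma lq_norm_le_iff:
  assumes "0 < Q"
  shows "lq_norm (ennreal Q) a \<le> b \<longleftrightarrow> (\<Sum>j. ennreal_powr (a j) Q) \<le> ennreal_powr b Q"
  using assms by (simp add: lq_norm_def ennreal_powr_le_iff)

lemma lq_norm_top: "lq_norm \<infinity> a = (SUP j. a j)" "lq_norm top a = (SUP j. a j)"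
  by (simp_all add: lq_norm_def)

lemma lq_norm_finite_powr:
  assumes "0 < Q"
  shows "ennreal_powr (lq_norm (ennreal Q) a) Q = (\<Sum>j. ennreal_powr (a j) Q)"
  using assms by (simp add: lq_norm_def ennreal_powr_inverse)

lemma exponent_pos: "1 \<le> p \<Longrightarrow> 0 < (p :: ennreal)"
  by (rule less_le_trans[OF zero_less_one])

lemma ennreal_exponent_cases:
  fixes q :: ennreal
  assumes "0 < q"
  obtains "q = \<infinity>" | Q where "q = ennreal Q" "0 < Q"
  using assms by (cases q) auto

lemma term_le_lq_norm:
  assumes "0 < q"
  shows "a n \<le> lq_norm q a"
  using assms
proof (cases rule: ennreal_exponent_cases)
  case 1
  then show ?thesis by (auto simp: lq_norm_top intro: SUP_upper)
next
  case (2 Q)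
  have "ennreal_powr (a n) Q \<le> (\<Sum>j. ennreal_powr (a j) Q)"
    using sum_le_suminf[OF summableI, of "{n}" "\<lambda>j. ennreal_powr (a j) Q"] by simp
  then have "ennreal_powr (ennreal_powr (a n) Q) (1 / Q)
      \<le> ennreal_powr (\<Sum>j. ennreal_powr (a j) Q) (1 / Q)"
    using 2 by (intro ennreal_powr_mono) auto
  then show ?thesis using 2 by (simp add: ennreal_powr_inverse lq_norm_def)
qed

text \<open>
  Each entry is at most \<open>S = lq_norm q a\<close>, so raising the exponent from \<open>Q\<close> to \<open>Q'\<close> costs a factor of at
  most \<open>S\<close> to the power \<open>Q' - Q\<close> in every summand.
\<close>

lemma lq_norm_antimono:
  assumes "0 < q" "q \<le> q'"
  shows "lq_norm q' a \<le> lq_norm q a"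
proof (cases "lq_norm q a")
  case (real S)
  have le: "a n \<le> ennreal S" for n using term_le_lq_norm[OF assms(1), of a n] real by simp
  define x where "x n = enn2real (a n)" for n
  have x: "a n = ennreal (x n)" "0 \<le> x n" "x n \<le> S" for n
    using le_less_trans[OF le[of n] ennreal_less_top] le[of n] real by (auto simp: x_def enn2real_leI)
  from assms have "0 < q'" by auto
  then show ?thesis
  proof (cases rule: ennreal_exponent_cases)
    case 1
    then show ?thesis using le real by (auto simp: lq_norm_top intro: SUP_least)
  next
    case (2 Q')
    with assms obtain Q where Q: "q = ennreal Q" "0 < Q" "Q \<le> Q'"
      by (cases q) (auto simp: top_unique)
    have "(\<Sum>j. ennreal_powr (a j) Q') \<le> (\<Sum>j. ennreal (S powr (Q' - Q)) * ennreal_powr (a j) Q)"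
    proof (intro suminf_le summableI)
      fix j
      have "x j powr Q' = x j powr (Q' - Q) * x j powr Q"
        by (simp add: powr_add[symmetric])
      also have "\<dots> \<le> S powr (Q' - Q) * x j powr Q"
        using x(2,3)[of j] Q by (intro mult_right_mono powr_mono2) auto
      finally show "ennreal_powr (a j) Q' \<le> ennreal (S powr (Q' - Q)) * ennreal_powr (a j) Q"
        using x[of j] by (simp add: ennreal_mult[symmetric])
    qed
    also have "\<dots> = ennreal (S powr (Q' - Q)) * ennreal_powr (lq_norm q a) Q"
      using Q by (simp add: lq_norm_finite_powr)
    also have "\<dots> = ennreal_powr (lq_norm q a) Q'"
      using real by (simp add: ennreal_mult[symmetric] powr_add[symmetric])
    finally show ?thesis
      using 2 by (simp add: lq_norm_le_iff)
  qed
qed simp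

lemma lq_norm_le_1_finite_support:
  assumes "0 < Q" "\<And>n. 0 \<le> y n" "\<And>n. N \<le> n \<Longrightarrow> y n = 0"
  shows "lq_norm (ennreal Q) (\<lambda>n. ennreal (y n)) \<le> 1 \<longleftrightarrow> (\<Sum>n<N. y n powr Q) \<le> 1"
proof -
  have "(\<Sum>n. ennreal (y n powr Q)) = (\<Sum>n<N. ennreal (y n powr Q))"
    using assms by (intro suminf_finite) auto
  also have "\<dots> = ennreal (\<Sum>n<N. y n powr Q)" by (simp add: sum_ennreal)
  finally show ?thesis
    using assms ennreal_powr_ennreal[of 1 Q] by (simp add: lq_norm_le_iff)
qed

lemma recip_exponent:
  fixes p :: ennreal
  assumes "1 \<le> p"
  shows "1 / p = ennreal (enn2real (1 / p))"
  using assms by (cases p; simp add: divide_ennreal ennreal_1[symmetric] del: ennreal_1)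

lemma exponent_ge_1_cases:
  fixes p :: ennreal
  assumes "1 \<le> p"
  obtains "p = \<infinity>" "enn2real (1 / p) = 0"
  | P where "p = ennreal P" "1 \<le> P" "enn2real (1 / p) = 1 / P"
  using assms by (cases p) (auto simp: divide_ennreal ennreal_1[symmetric] simp del: ennreal_1)

text \<open>
  The vector \<open>z\<close> is the weighted \<open>\<ell>\<^sub>p\<close> mean \<open>(\<Sum>\<^sub>n \<theta>\<^sub>n y\<^sub>n\<^bsup>p\<^esup>)\<^bsup>1/p\<^esup>\<close>, whose \<open>p\<close>-th power has total mass at most
  \<open>\<Sum>\<theta>\<^sub>n\<close>. For \<open>p = \<infinity>\<close> the weights disappear, and the indicator of the common support dominates everything
  in the unit ball. It is this step that merges the test vectors found separately for each value of the
  outermost index.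
\<close>

lemma unit_ball_combine:
  fixes y :: "'n \<Rightarrow> nat \<Rightarrow> real" and \<theta> :: "'n \<Rightarrow> real"
  assumes "finite F" and \<theta>: "\<And>n. n \<in> F \<Longrightarrow> 0 < \<theta> n" "sum \<theta> F \<le> 1" and p: "1 \<le> p"
    and y: "\<And>n t. n \<in> F \<Longrightarrow> 0 \<le> y n t" "\<And>n t. n \<in> F \<Longrightarrow> N \<le> t \<Longrightarrow> y n t = 0"
    and ball: "\<And>n. n \<in> F \<Longrightarrow> lq_norm p (\<lambda>t. ennreal (y n t)) \<le> 1"
  shows "\<exists>z. (\<forall>t. 0 \<le> z t) \<and> (\<forall>t\<ge>N. z t = 0) \<and> lq_norm p (\<lambda>t. ennreal (z t)) \<le> 1 \<and>
    (\<forall>n\<in>F. \<forall>t. \<theta> n powr enn2real (1 / p) * y n t \<le> z t)"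
  using p
proof (cases rule: exponent_ge_1_cases)
  case 1
  define z :: "nat \<Rightarrow> real" where "z t = (if t < N then 1 else 0)" for t
  have "y n t \<le> z t" if "n \<in> F" for n t
  proof (cases "t < N")
    case True
    have "ennreal (y n t) \<le> lq_norm p (\<lambda>t. ennreal (y n t))"
      by (rule term_le_lq_norm) (rule exponent_pos[OF p])
    also note ball[OF that]
    finally have "y n t \<le> 1" by simp
    then show ?thesis using True by (simp add: z_def)
  qed (use that y in \<open>simp add: z_def\<close>)
  moreover have "lq_norm p (\<lambda>t. ennreal (z t)) \<le> 1"
    unfolding 1 lq_norm_top by (rule SUP_least) (simp add: z_def)
  ultimately show ?thesis using \<theta>(1)
    by (intro exI[of _ z]) (auto simp: 1 z_def less_imp_neq[symmetric])
next
  case (2 P)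
  define z where "z t = (\<Sum>n\<in>F. \<theta> n * y n t powr P) powr (1 / P)" for t
  have zP: "z t powr P = (\<Sum>n\<in>F. \<theta> n * y n t powr P)" for t
    using 2 \<theta>(1) y by (simp add: z_def powr_powr sum_nonneg less_imp_le)
  have z: "0 \<le> z t" "N \<le> t \<Longrightarrow> z t = 0" for t
    by (auto simp: z_def y)
  have "(\<Sum>t<N. z t powr P) = (\<Sum>n\<in>F. \<theta> n * (\<Sum>t<N. y n t powr P))"
    unfolding zP sum_distrib_left by (rule sum.swap)
  also have "\<dots> \<le> (\<Sum>n\<in>F. \<theta> n * 1)"
  proof (intro sum_mono mult_left_mono)
    fix n assume n: "n \<in> F"
    show "(\<Sum>t<N. y n t powr P) \<le> 1"
      using lq_norm_le_1_finite_support[of P "y n" N] ball[OF n] y[OF n] 2 by auto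
  qed (use \<theta> in \<open>auto intro: less_imp_le\<close>)
  also have "\<dots> \<le> 1" using \<theta>(2) by simp
  finally have "lq_norm p (\<lambda>t. ennreal (z t)) \<le> 1"
    using lq_norm_le_1_finite_support[of P z N] z 2 by auto
  moreover have "\<theta> n powr enn2real (1 / p) * y n t \<le> z t" if n: "n \<in> F" for n t
  proof -
    have "\<theta> n powr enn2real (1 / p) * y n t = (\<theta> n * y n t powr P) powr (1 / P)"
      using 2 \<theta>(1)[OF n] y(1)[OF n] by (simp add: powr_mult powr_powr)
    also have "\<dots> \<le> z t"
      unfolding z_def using n \<open>finite F\<close> less_imp_le[OF \<theta>(1)] 2
      by (intro powr_mono2 member_le_sum) auto
    finally show ?thesis .
  qed
  ultimately show ?thesis using z by blast
qed

text \<open>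
  One half of the duality between \<open>\<ell>\<^bsub>1/s\<^esub>\<close> and \<open>\<ell>\<^bsub>1/(1-s)\<^esub>\<close>, with the dual sequence written as \<open>\<theta>\<^sub>n\<^bsup>s\<^esup>\<close> for a
  weight \<open>\<theta>\<close> of mass at most \<open>1\<close>; for \<open>s \<ge> 1\<close> a single point mass suffices. Only finitely many
  entries are used, and each \<open>b n\<close> is replaced by a smaller real \<open>\<gamma> n\<close>: the inner mixed norms are suprema,
  which test vectors approach but need not reach.
\<close>

lemma lq_norm_dual_approx:
  fixes c :: ennreal and b :: "nat \<Rightarrow> ennreal"
  assumes c: "c < lq_norm q b" and s: "0 \<le> s"
    and q: "q = \<infinity> \<or> s < 1 \<and> q = ennreal (1 / (1 - s))"
  shows "\<exists>F \<theta> \<gamma>. finite F \<and> (\<forall>n\<in>F. 0 < \<theta> n \<and> 0 < \<gamma> n \<and> ennreal (\<gamma> n) < b n) \<and>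
    sum \<theta> F \<le> (1::real) \<and> c \<le> ennreal (\<Sum>n\<in>F. \<theta> n powr s * \<gamma> n)"
proof (cases "\<exists>n. c < b n")
  case True
  then obtain n where "c < b n" by blast
  then obtain d where d: "c < d" "d < b n" using dense by blast
  then have "d < \<infinity>" by (metis infinity_ennreal_def less_top top.not_eq_extremum order_less_trans)
  then obtain g where g: "d = ennreal g" "0 \<le> g" by (cases d) auto
  then have "0 < g" using d by (cases "g = 0") auto
  then show ?thesis
    using d g by (intro exI[of _ "{n}"] exI[of _ "\<lambda>_. 1"] exI[of _ "\<lambda>_. g"]) auto
next
  case False
  \<comment> \<open>Now all entries are finite, so the rest takes place in the reals.\<close>
  then have bc: "b n \<le> c" for n by (meson leI)
  have "q \<noteq> \<infinity>"
  proof
    assume "q = \<infinity>"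
    then have "lq_norm q b \<le> c" using bc by (auto simp: lq_norm_top intro: SUP_least)
    then show False using c by simp
  qed
  with q have s1: "s < 1" and "q = ennreal (1 / (1 - s))" by auto
  define Q where "Q = 1 / (1 - s)"
  have Q: "q = ennreal Q" "0 < Q" "Q * s + 1 = Q" "1 / Q = 1 - s"
    using s1 \<open>q = _\<close> by (auto simp: Q_def field_simps)
  obtain C where C: "c = ennreal C" "0 \<le> C" using c by (cases c) auto
  define x where "x n = enn2real (b n)" for n
  have x: "b n = ennreal (x n)" "0 \<le> x n" for n
    using le_less_trans[OF bc[of n]] C by (auto simp: x_def)
  have "ennreal (C powr Q) < (\<Sum>n. ennreal (x n powr Q))"
  proof (rule ccontr)
    assume "\<not> ?thesis"
    then have "lq_norm q b \<le> c"
      using C Q x by (simp add: lq_norm_le_iff)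
    then show False using c by simp
  qed
  also have "\<dots> = (SUP M. \<Sum>n<M. ennreal (x n powr Q))"
    by (rule suminf_eq_SUP)
  finally obtain M where M: "ennreal (C powr Q) < (\<Sum>n<M. ennreal (x n powr Q))"
    by (auto simp: less_SUP_iff)
  define S where "S = (\<Sum>n<M. x n powr Q)"
  have "C powr Q < S"
    using M by (simp add: S_def sum_ennreal ennreal_less_iff)
  then obtain T where T: "C powr Q < T" "T < S" using dense by blast
  have T0: "0 < T" "0 < S" using T by (smt (verit) powr_ge_zero)+
  \<comment> \<open>Shrinking the entries \<open>x n\<close> by \<open>lam < 1\<close> makes \<open>\<gamma> n < b n\<close> strict; since \<open>T\<close> exceeds \<open>C powr Q\<close>, the bound \<open>c\<close> is still reached.\<close>
  define lam where "lam = (T / S) powr (1 / Q)"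
  have lam: "0 < lam" "lam < 1"
    using T T0 Q(2) powr_less_mono2[of "1 / Q" "T / S" 1] by (auto simp: lam_def)
  \<comment> \<open>Null entries are left out because \<open>\<theta> n\<close> and \<open>\<gamma> n\<close> are to be positive.\<close>
  define F where "F = {n. n < M \<and> 0 < x n}"
  have F: "finite F" by (simp add: F_def)
  have SF: "S = (\<Sum>n\<in>F. x n powr Q)"
    unfolding S_def by (rule sum.mono_neutral_right) (use x(2) in \<open>auto simp: F_def less_le\<close>)
  define \<theta> where "\<theta> n = x n powr Q / S" for n
  define \<gamma> where "\<gamma> n = lam * x n" for n
  \<comment> \<open>The weights \<open>\<theta> n\<close> proportional to \<open>x n powr Q\<close> are those of equality in Hoelder; \<open>Q * s + 1 = Q\<close> turns every summand into a multiple of \<open>x n powr Q\<close>.\<close>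
  have "(\<Sum>n\<in>F. \<theta> n powr s * \<gamma> n) = (\<Sum>n\<in>F. lam / S powr s * x n powr Q)"
  proof (rule sum.cong)
    fix n assume "n \<in> F"
    then have "0 < x n" by (simp add: F_def)
    then have xQ: "x n powr Q = x n powr (Q * s) * x n"
      by (metis Q(3) powr_add powr_one less_imp_le)
    have "\<theta> n powr s = x n powr (Q * s) / S powr s"
      using T0 \<open>0 < x n\<close> by (simp add: \<theta>_def powr_divide powr_powr)
    then show "\<theta> n powr s * \<gamma> n = lam / S powr s * x n powr Q"
      by (simp add: \<gamma>_def xQ)
  qed simp
  also have "\<dots> = lam * (S / S powr s)"
    unfolding sum_distrib_left[symmetric] SF[symmetric] by simp
  also have "S / S powr s = S powr (1 / Q)"
    using T0 by (simp add: Q powr_diff)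
  also have "lam * S powr (1 / Q) = T powr (1 / Q)"
    using T0 by (simp add: lam_def powr_divide)
  finally have sum_eq: "(\<Sum>n\<in>F. \<theta> n powr s * \<gamma> n) = T powr (1 / Q)" .
  have "C = (C powr Q) powr (1 / Q)" using Q(2) C by (simp add: powr_powr)
  also have "\<dots> \<le> T powr (1 / Q)" using T Q(2) by (intro powr_mono2) auto
  finally have "c \<le> ennreal (\<Sum>n\<in>F. \<theta> n powr s * \<gamma> n)"
    using C by (simp add: sum_eq ennreal_leI)
  moreover have "sum \<theta> F \<le> 1"
    using T0 by (simp add: \<theta>_def sum_divide_distrib[symmetric] SF[symmetric])
  moreover have "\<forall>n\<in>F. 0 < \<theta> n \<and> 0 < \<gamma> n \<and> ennreal (\<gamma> n) < b n"
    using T0 lam by (auto simp: \<theta>_def \<gamma>_def F_def x(1) ennreal_less_iff)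
  ultimately show ?thesis using F by blast
qed

section \<open>Test vectors for mixed norms\<close>

text \<open>
  The value \<open>\<Sum> a\<^bsub>j\<^esub> \<Prod> x\<^bsub>i,j(i)\<^esub>\<close> of a form with coefficients \<open>a\<close>, cut off at \<open>N\<close> in every slot listed. It is
  organised by the same recursion over slots as \<open>mixed_norm\<close>, so that the two can be compared by induction.
\<close>

fun pairing :: "nat \<Rightarrow> nat list \<Rightarrow> ((nat \<Rightarrow> nat) \<Rightarrow> real) \<Rightarrow> (nat \<Rightarrow> nat \<Rightarrow> real) \<Rightarrow> (nat \<Rightarrow> nat) \<Rightarrow> real" where
  "pairing N [] a x j = a j"
| "pairing N (i # is) a x j = (\<Sum>n<N. x i n * pairing N is a x (j(i := n)))"

lemma pairing_nonneg:
  assumes "\<And>j. 0 \<le> a j" "\<And>i n. i \<in> set is \<Longrightarrow> 0 \<le> x i n"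
  shows "0 \<le> pairing N is a x j"
  using assms(2) by (induction "is" arbitrary: j) (auto intro!: sum_nonneg mult_nonneg_nonneg assms(1))

lemma pairing_cong:
  assumes "\<And>i. i \<in> set is \<Longrightarrow> x i = x' i"
  shows "pairing N is a x j = pairing N is a x' j"
  using assms by (induction "is" arbitrary: j) auto

lemma pairing_truncate:
  assumes "N \<le> N'" "\<And>i n. i \<in> set is \<Longrightarrow> N \<le> n \<Longrightarrow> x i n = 0"
  shows "pairing N' is a x j = pairing N is a x j"
  using assms(2)
proof (induction "is" arbitrary: j)
  case (Cons i "is")
  then have "pairing N' (i # is) a x j = (\<Sum>n<N'. x i n * pairing N is a x (j(i := n)))"
    by simp
  also have "\<dots> = (\<Sum>n<N. x i n * pairing N is a x (j(i := n)))"
    using assms(1) Cons.prems by (intro sum.mono_neutral_right) auto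
  finally show ?case by simp
qed simp

text \<open>
  Enlarging the \<open>i\<close>-th vector by \<open>\<theta>\<close> to the power \<open>r i\<close> multiplies the multilinear pairing by the product
  of these powers, so the exponents add up.
\<close>

lemma pairing_scale_mono:
  fixes r :: "nat \<Rightarrow> real"
  assumes "0 < \<theta>" and a: "\<And>j. 0 \<le> a j"
    and "\<And>i n. i \<in> set is \<Longrightarrow> 0 \<le> x i n"
    and "\<And>i n. i \<in> set is \<Longrightarrow> \<theta> powr r i * x i n \<le> z i n"
  shows "\<theta> powr (\<Sum>i\<leftarrow>is. r i) * pairing N is a x j \<le> pairing N is a z j"
  using assms(3,4)
proof (induction "is" arbitrary: j)
  case Nil
  then show ?case using assms(1) by simp
next
  case (Cons i "is")
  have "\<theta> powr (\<Sum>i\<leftarrow>i # is. r i) * pairing N (i # is) a x j =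
      (\<Sum>n<N. (\<theta> powr r i * x i n) * (\<theta> powr (\<Sum>i\<leftarrow>is. r i) * pairing N is a x (j(i := n))))"
    by (simp add: powr_add sum_distrib_left mult_ac)
  also have "\<dots> \<le> (\<Sum>n<N. z i n * pairing N is a z (j(i := n)))"
  proof (intro sum_mono mult_mono)
    fix n
    show "\<theta> powr (\<Sum>i\<leftarrow>is. r i) * pairing N is a x (j(i := n)) \<le> pairing N is a z (j(i := n))"
      by (rule Cons.IH) (use Cons.prems in auto)
    show "0 \<le> z i n"
      using Cons.prems(1)[of i n] Cons.prems(2)[of i n]
      by (smt (verit) list.set_intros(1) mult_nonneg_nonneg powr_ge_zero)
    show "0 \<le> \<theta> powr (\<Sum>i\<leftarrow>is. r i) * pairing N is a x (j(i := n))"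
      using Cons.prems(1) a by (intro mult_nonneg_nonneg pairing_nonneg) auto
    show "\<theta> powr r i * x i n \<le> z i n" using Cons.prems(2) by simp
  qed
  finally show ?case by simp
qed

definition test_tuple :: "nat \<Rightarrow> (nat \<Rightarrow> ennreal) \<Rightarrow> nat \<Rightarrow> (nat \<Rightarrow> nat \<Rightarrow> real) \<Rightarrow> bool" where
  "test_tuple m p N x \<longleftrightarrow> (\<forall>i\<in>{1..m}. (\<forall>n. 0 \<le> x i n) \<and> (\<forall>n\<ge>N. x i n = 0) \<and>
     lq_norm (p i) (\<lambda>n. ennreal (x i n)) \<le> 1)"

lemma lq_norm_unit_le_1:
  assumes "0 < p"
  shows "lq_norm p (\<lambda>t. ennreal (of_bool (t = n))) \<le> 1"
  using assms
proof (cases rule: ennreal_exponent_cases)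
  case 1
  then show ?thesis by (auto simp: lq_norm_top intro!: SUP_least)
next
  case (2 Q)
  have "(\<Sum>t<Suc n. of_bool (t = n) powr Q) = (\<Sum>t<Suc n. if t = n then 1 else 0 :: real)"
    by (intro sum.cong) auto
  also have "\<dots> = 1" by simp
  finally show ?thesis
    using 2 lq_norm_le_1_finite_support[of Q "\<lambda>t. of_bool (t = n)" "Suc n"] by auto
qed

lemma delta_eq:
  assumes "\<forall>i\<in>{k..m}. 1 \<le> s i"
  shows "delta s k m = (let S = (\<Sum>i=k..m. enn2real (1 / s i)) in if S < 1 then ennreal (1 / (1 - S)) else \<infinity>)"
proof -
  define S where "S = (\<Sum>i=k..m. enn2real (1 / s i))"
  have "(\<Sum>i=k..m. 1 / s i) = (\<Sum>i=k..m. ennreal (enn2real (1 / s i)))"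
    using assms by (intro sum.cong recip_exponent) auto
  also have "\<dots> = ennreal S" unfolding S_def by (rule sum_ennreal) simp
  finally have S: "(\<Sum>i=k..m. 1 / s i) = ennreal S" .
  have S0: "0 \<le> S" by (simp add: S_def sum_nonneg)
  then have lt: "ennreal S < 1 \<longleftrightarrow> S < 1" using ennreal_less_iff[of S 1] by simp
  have "1 / (1 - ennreal S) = ennreal (1 / (1 - S))" if "S < 1"
    using that S0 by (simp add: ennreal_minus divide_ennreal ennreal_1[symmetric] del: ennreal_1)
  then show ?thesis
    unfolding delta_def S lt Let_def S_def[symmetric] by simp
qed

lemma sum_list_upt_eq_sum: "(\<Sum>i\<leftarrow>[k..<Suc m]. f i) = (\<Sum>i=k..m. f i)"
  by (metis atLeastLessThanSuc_atLeastAtMost interv_sum_list_conv_sum_set_nat set_upt)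

text \<open>
  The heart of the sufficiency: the critical mixed norms are dominated by the norm of the form. Stated for
  the norms in the positions \<open>k, \<dots>, m\<close> with the remaining indices frozen in \<open>j\<close>, so that it can be proved
  by induction from \<open>k = m + 1\<close> down to \<open>k = 1\<close>.
\<close>

lemma mixed_norm_attained:
  fixes a :: "(nat \<Rightarrow> nat) \<Rightarrow> real" and p q :: "nat \<Rightarrow> ennreal"
  assumes p: "\<forall>i\<in>{1..m}. 1 \<le> p i" and \<sigma>: "bij_betw \<sigma> {1..m} {1..m}"
    and q: "\<forall>k\<in>{1..m}. delta (\<lambda>i. p (\<sigma> i)) k m \<le> q k"
    and a: "\<And>j. 0 \<le> a j"
    and k: "1 \<le> k" "k \<le> Suc m"
    and c: "c < mixed_norm (map (\<lambda>k. (\<sigma> k, q k)) [k..<Suc m]) (\<lambda>j. ennreal (a j)) j"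
  shows "\<exists>N x. test_tuple m p N x \<and> c \<le> ennreal (pairing N (map \<sigma> [k..<Suc m]) a x j)"
  using k(2) k(1) c
proof (induction arbitrary: c j rule: inc_induct)
  case base
  have "test_tuple m p 0 (\<lambda>_ _. 0)"
    using p by (auto simp: test_tuple_def lq_norm_def ennreal_powr_def zero_ennreal.rep_eq)
  then show ?case using base by (intro exI[of _ 0] exI[of _ "\<lambda>_ _. 0"]) (auto intro: less_imp_le)
next
  case (step k)
  define r where "r i = enn2real (1 / p i)" for i
  define s where "s = (\<Sum>i=k..m. r (\<sigma> i))"
  define rest where "rest = map \<sigma> [Suc k..<Suc m]"
  define L where "L = map (\<lambda>k. (\<sigma> k, q k)) [Suc k..<Suc m]"
  define b where "b = (\<lambda>n. mixed_norm L (\<lambda>j. ennreal (a j)) (j(\<sigma> k := n)))"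
  have km: "k \<in> {1..m}" "k < Suc m" using step by auto
  have \<sigma>_mem: "\<sigma> i \<in> {1..m}" if "i \<in> {1..m}" for i
    by (rule bij_betw_apply[OF \<sigma> that])
  have r0: "0 \<le> r i" for i by (simp add: r_def)
  have s0: "0 \<le> s" by (simp add: s_def sum_nonneg r0)
  have "set rest = \<sigma> ` {Suc k..m}"
    by (simp add: rest_def atLeastLessThanSuc_atLeastAtMost del: upt_Suc)
  moreover have "inj_on \<sigma> {1..m}" using \<sigma> by (simp add: bij_betw_def)
  then have "\<sigma> k \<notin> \<sigma> ` {Suc k..m}"
    using km by (subst inj_on_image_mem_iff) auto
  ultimately have rest: "set rest \<subseteq> {1..m}" "\<sigma> k \<notin> set rest"
    using \<sigma>_mem by auto
  define d where "d = delta (\<lambda>i. p (\<sigma> i)) k m"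
  have d_eq: "d = (if s < 1 then ennreal (1 / (1 - s)) else \<infinity>)"
    unfolding d_def s_def r_def using p \<sigma>_mem km by (subst delta_eq) (auto simp: Let_def)
  have "c < lq_norm (q k) b"
    using step.prems km(2) by (simp add: upt_conv_Cons b_def L_def del: upt_Suc)
  also have "\<dots> \<le> lq_norm d b"
  proof (rule lq_norm_antimono)
    show "d \<le> q k" unfolding d_def using q km(1) by blast
    show "0 < d" using d_eq by simp
  qed
  finally have "c < lq_norm d b" .
  then obtain F \<theta> \<gamma> where F: "finite F"
    and \<theta>\<gamma>: "\<And>n. n \<in> F \<Longrightarrow> 0 < \<theta> n \<and> 0 < \<gamma> n \<and> ennreal (\<gamma> n) < b n"
    and \<theta>_sum: "sum \<theta> F \<le> (1::real)" and c_le: "c \<le> ennreal (\<Sum>n\<in>F. \<theta> n powr s * \<gamma> n)"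
    using lq_norm_dual_approx[of c d b s] s0 d_eq by (auto split: if_splits)
  have "\<forall>n\<in>F. \<exists>N x. test_tuple m p N x \<and> ennreal (\<gamma> n) \<le> ennreal (pairing N rest a x (j(\<sigma> k := n)))"
    using step.IH \<theta>\<gamma> by (auto simp: b_def L_def rest_def simp del: upt_Suc)
  then obtain M X where MX: "\<And>n. n \<in> F \<Longrightarrow> test_tuple m p (M n) (X n)"
    and "\<And>n. n \<in> F \<Longrightarrow> ennreal (\<gamma> n) \<le> ennreal (pairing (M n) rest a (X n) (j(\<sigma> k := n)))"
    by metis
  then have \<gamma>_le: "\<gamma> n \<le> pairing (M n) rest a (X n) (j(\<sigma> k := n))" if "n \<in> F" for n
    using that \<theta>\<gamma>[OF that] by (smt (verit) ennreal_le_iff2)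
  define N where "N = (\<Sum>n\<in>F. M n + Suc n)"
  have N: "M n \<le> N" "n < N" if "n \<in> F" for n
    using member_le_sum[of n F "\<lambda>n. M n + Suc n"] F that by (auto simp: N_def)
  \<comment> \<open>The slot \<open>\<sigma> k\<close> itself is tested by the unit vector at \<open>n\<close>, so that combining treats all slots alike and yields the factor \<open>\<theta> n powr r (\<sigma> k)\<close> there.\<close>
  define y where "y n i = (if i = \<sigma> k then (\<lambda>t. of_bool (t = n)) else X n i)" for n i
  have y: "0 \<le> y n i t" "N \<le> t \<Longrightarrow> y n i t = 0" "lq_norm (p i) (\<lambda>t. ennreal (y n i t)) \<le> 1"
    if "n \<in> F" "i \<in> {1..m}" for n i t
  proof -
    have "0 < p i" using p that by (blast intro: exponent_pos)
    then show "0 \<le> y n i t" "N \<le> t \<Longrightarrow> y n i t = 0" "lq_norm (p i) (\<lambda>t. ennreal (y n i t)) \<le> 1"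
      using MX[OF that(1)] N[OF that(1)] that(2) lq_norm_unit_le_1[of "p i" n]
      by (auto simp: y_def test_tuple_def)
  qed
  have "\<forall>i\<in>{1..m}. \<exists>z. (\<forall>t. 0 \<le> z t) \<and> (\<forall>t\<ge>N. z t = 0) \<and> lq_norm (p i) (\<lambda>t. ennreal (z t)) \<le> 1 \<and>
      (\<forall>n\<in>F. \<forall>t. \<theta> n powr r i * y n i t \<le> z t)"
  proof
    fix i assume i: "i \<in> {1..m}"
    show "\<exists>z. (\<forall>t. 0 \<le> z t) \<and> (\<forall>t\<ge>N. z t = 0) \<and> lq_norm (p i) (\<lambda>t. ennreal (z t)) \<le> 1 \<and>
      (\<forall>n\<in>F. \<forall>t. \<theta> n powr r i * y n i t \<le> z t)"
      unfolding r_def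
      by (rule unit_ball_combine) (use F \<theta>\<gamma> \<theta>_sum p i y in auto)
  qed
  then obtain z where z: "\<And>i t. i \<in> {1..m} \<Longrightarrow> 0 \<le> z i t" "test_tuple m p N z"
    and z_ge: "\<And>i n t. i \<in> {1..m} \<Longrightarrow> n \<in> F \<Longrightarrow> \<theta> n powr r i * y n i t \<le> z i t"
    unfolding test_tuple_def by metis
  have "(\<Sum>n\<in>F. \<theta> n powr s * \<gamma> n)
      \<le> (\<Sum>n\<in>F. z (\<sigma> k) n * pairing N rest a z (j(\<sigma> k := n)))"
  proof (rule sum_mono)
    fix n assume n: "n \<in> F"
    have "s = r (\<sigma> k) + (\<Sum>i\<leftarrow>rest. r i)"
      using km unfolding s_def rest_def map_map comp_def sum_list_upt_eq_sum
      by (simp add: sum.atLeast_Suc_atMost)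
    then have "\<theta> n powr s * \<gamma> n = \<theta> n powr r (\<sigma> k) * (\<theta> n powr (\<Sum>i\<leftarrow>rest. r i) * \<gamma> n)"
      by (simp add: powr_add)
    also have "\<dots> \<le> z (\<sigma> k) n * pairing N rest a z (j(\<sigma> k := n))"
    proof (rule mult_mono)
      show "\<theta> n powr r (\<sigma> k) \<le> z (\<sigma> k) n"
        using z_ge[OF \<sigma>_mem[OF km(1)] n, of n] by (simp add: y_def)
      have "\<gamma> n \<le> pairing (M n) rest a (X n) (j(\<sigma> k := n))" by (rule \<gamma>_le[OF n])
      also have "\<dots> = pairing N rest a (X n) (j(\<sigma> k := n))"
        using MX[OF n] N(1)[OF n] rest(1)
        by (intro pairing_truncate[symmetric]) (auto simp: test_tuple_def)
      also have "\<dots> = pairing N rest a (y n) (j(\<sigma> k := n))"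
        using rest(2) by (intro pairing_cong) (auto simp: y_def)
      finally have "\<theta> n powr (\<Sum>i\<leftarrow>rest. r i) * \<gamma> n
          \<le> \<theta> n powr (\<Sum>i\<leftarrow>rest. r i) * pairing N rest a (y n) (j(\<sigma> k := n))"
        by (intro mult_left_mono) auto
      also have "\<dots> \<le> pairing N rest a z (j(\<sigma> k := n))"
        by (rule pairing_scale_mono) (use \<theta>\<gamma> n a y z_ge rest(1) in auto)
      finally show "\<theta> n powr (\<Sum>i\<leftarrow>rest. r i) * \<gamma> n \<le> pairing N rest a z (j(\<sigma> k := n))" .
    qed (use z \<sigma>_mem km \<theta>\<gamma>[OF n] in auto)
    finally show "\<theta> n powr s * \<gamma> n \<le> z (\<sigma> k) n * pairing N rest a z (j(\<sigma> k := n))" .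
  qed
  also have "\<dots> \<le> (\<Sum>n<N. z (\<sigma> k) n * pairing N rest a z (j(\<sigma> k := n)))"
    using N(2) z(1) \<sigma>_mem km rest(1) a
    by (intro sum_mono2 mult_nonneg_nonneg pairing_nonneg) auto
  also have "\<dots> = pairing N (map \<sigma> [k..<Suc m]) a z j"
    using km by (simp add: upt_conv_Cons rest_def del: upt_Suc)
  finally have "c \<le> ennreal (pairing N (map \<sigma> [k..<Suc m]) a z j)"
    using c_le ennreal_leI order_trans by blast
  then show ?case using z(2) by blast
qed

section \<open>Multilinear forms on finitely supported vectors\<close>

lemma finite_support_in_X_space:
  fixes u :: "nat \<Rightarrow> 'k::real_normed_field"
  assumes "0 < p" "\<And>n. N \<le> n \<Longrightarrow> u n = 0"
  shows "u \<in> X_space p"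
  using assms(1)
proof (cases rule: ennreal_exponent_cases)
  case 1
  have "\<forall>\<^sub>F n in sequentially. u n = 0"
    using assms(2) eventually_sequentially by blast
  then show ?thesis using 1 by (simp add: X_space_def tendsto_eventually)
next
  case (2 P)
  have "(\<Sum>n. ennreal (norm (u n) powr P)) = (\<Sum>n<N. ennreal (norm (u n) powr P))"
    using assms 2 by (intro suminf_finite) auto
  also have "\<dots> = ennreal (\<Sum>n<N. norm (u n) powr P)" by (simp add: sum_ennreal)
  finally show ?thesis
    using 2 by (simp add: X_space_def X_norm_def lq_norm_def sum_nonneg)
qed

lemma multilinear_form_finite_support:
  fixes A :: "(nat \<Rightarrow> nat \<Rightarrow> 'k::real_normed_field) \<Rightarrow> 'k"
  assumes A: "multilinear_form m p A" and x: "x \<in> X_prod m p" and i: "i \<in> {1..m}" "0 < p i"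
    and u: "\<And>n. N \<le> n \<Longrightarrow> u n = 0"
  shows "A (x(i := u)) = (\<Sum>n<N. u n * A (x(i := unit_seq n)))"
  using u
proof (induction N arbitrary: u)
  note lin = A[unfolded multilinear_form_def, THEN bspec, OF x, THEN bspec, OF i(1)]
  case 0
  then have u0: "(\<lambda>n. 0 * u n) = u" by auto
  have "A (x(i := (\<lambda>n. 0 * u n))) = 0 * A (x(i := u))"
    by (rule lin[THEN bspec, OF finite_support_in_X_space, THEN conjunct2, THEN spec])
      (use i 0 in auto)
  then show ?case unfolding u0 by (simp only: lessThan_0 sum.empty mult_zero_left)
next
  note lin = A[unfolded multilinear_form_def, THEN bspec, OF x, THEN bspec, OF i(1)]
  case (Suc N)
  \<comment> \<open>Split off the last coordinate of \<open>u\<close>.\<close>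
  define v where "v = u(N := 0)"
  have v: "v n = 0" if "N \<le> n" for n using Suc.prems that by (cases "n = N") (auto simp: v_def)
  have e: "unit_seq N \<in> X_space (p i)"
    using i by (intro finite_support_in_X_space[of _ "Suc N"]) (auto simp: unit_seq_def)
  have e': "(\<lambda>n. u N * unit_seq N n) \<in> X_space (p i)"
    using i by (intro finite_support_in_X_space[of _ "Suc N"]) (auto simp: unit_seq_def)
  have vX: "v \<in> X_space (p i)" by (rule finite_support_in_X_space[OF i(2) v])
  have u_eq: "(\<lambda>n. v n + u N * unit_seq N n) = u" by (auto simp: v_def unit_seq_def)
  have "A (x(i := (\<lambda>n. v n + u N * unit_seq N n)))
      = A (x(i := v)) + A (x(i := (\<lambda>n. u N * unit_seq N n)))"
    by (rule lin[THEN bspec, OF vX, THEN conjunct1, THEN bspec, OF e'])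
  also have "A (x(i := (\<lambda>n. u N * unit_seq N n))) = u N * A (x(i := unit_seq N))"
    by (rule lin[THEN bspec, OF e, THEN conjunct2, THEN spec])
  finally have "A (x(i := u)) = A (x(i := v)) + u N * A (x(i := unit_seq N))"
    unfolding u_eq .
  also have "A (x(i := v)) = (\<Sum>n<N. v n * A (x(i := unit_seq n)))"
    using v by (rule Suc.IH)
  also have "\<dots> = (\<Sum>n<N. u n * A (x(i := unit_seq n)))"
    by (intro sum.cong) (auto simp: v_def)
  finally show ?case by (simp only: sum.lessThan_Suc)
qed

text \<open>
  Expanding a form in the slots listed in \<open>is\<close>, one after the other, while the other slots hold the unit
  vectors prescribed by \<open>j\<close>. This leads from the array of coefficients back to values of the form.
\<close>

lemma form_eq_pairing:
  fixes A :: "(nat \<Rightarrow> nat \<Rightarrow> 'k::real_normed_field) \<Rightarrow> 'k"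
  assumes A: "multilinear_form m p A" and p: "\<forall>i\<in>{1..m}. 0 < p i"
    and a: "\<And>j. form_coeff m A j = of_real (a j)" and x: "test_tuple m p N x"
    and "distinct is" "set is \<subseteq> {1..m}"
  shows "A (\<lambda>i\<in>{1..m}. if i \<in> set is then (\<lambda>n. of_real (x i n)) else unit_seq (j i))
    = of_real (pairing N is a x j)"
  using assms(5,6)
proof (induction "is" arbitrary: j)
  case Nil
  then show ?case
    using a[of j] unfolding form_coeff_def by (simp only: list.set empty_iff if_False pairing.simps)
next
  case (Cons i "is")
  define T :: "nat list \<Rightarrow> (nat \<Rightarrow> nat) \<Rightarrow> nat \<Rightarrow> nat \<Rightarrow> 'k"
    where "T is j = (\<lambda>i\<in>{1..m}. if i \<in> set is then (\<lambda>n. of_real (x i n)) else unit_seq (j i))"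
    for "is" j
  have i: "i \<in> {1..m}" "i \<notin> set is" using Cons.prems by auto
  have "T is j \<in> X_prod m p"
  proof -
    have "(if i \<in> set is then (\<lambda>n. of_real (x i n)) else unit_seq (j i)) \<in> X_space (p i)"
      if "i \<in> {1..m}" for i
      using that x p finite_support_in_X_space[of "p i" N "\<lambda>n. of_real (x i n)"]
        finite_support_in_X_space[of "p i" "Suc (j i)" "unit_seq (j i)"]
      by (auto simp: test_tuple_def unit_seq_def)
    then show ?thesis unfolding T_def X_prod_def restrict_PiE_iff by blast
  qed
  have "T (i # is) j = (T is j)(i := (\<lambda>n. of_real (x i n)))"
    using i by (auto simp: T_def fun_eq_iff)
  then have "A (T (i # is) j) = A ((T is j)(i := (\<lambda>n. of_real (x i n))))" by (rule arg_cong)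
  also have "\<dots> = (\<Sum>n<N. of_real (x i n) * A ((T is j)(i := unit_seq n)))"
    using A i p x \<open>T is j \<in> X_prod m p\<close>
    by (intro multilinear_form_finite_support) (auto simp: test_tuple_def)
  also have "\<dots> = (\<Sum>n<N. of_real (x i n) * of_real (pairing N is a x (j(i := n))))"
  proof (intro sum.cong refl arg_cong2[where f = "(*)"])
    fix n
    have "(T is j)(i := unit_seq n) = T is (j(i := n))"
      using i by (auto simp: T_def fun_eq_iff)
    moreover have "A (T is (j(i := n))) = of_real (pairing N is a x (j(i := n)))"
      unfolding T_def by (rule Cons.IH) (use Cons.prems in auto)
    ultimately show "A ((T is j)(i := unit_seq n)) = of_real (pairing N is a x (j(i := n)))"
      by (simp only:)
  qed
  finally have "A (T (i # is) j) = of_real (pairing N (i # is) a x j)"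
    by (simp only: pairing.simps of_real_sum of_real_mult)
  then show ?case unfolding T_def .
qed

lemma form_mixed_norm_le_form_norm:
  fixes A :: "(nat \<Rightarrow> nat \<Rightarrow> 'k::real_normed_field) \<Rightarrow> 'k"
  assumes p: "\<forall>i\<in>{1..m}. 1 \<le> p i" and \<sigma>: "bij_betw \<sigma> {1..m} {1..m}"
    and q: "\<forall>k\<in>{1..m}. delta (\<lambda>i. p (\<sigma> i)) k m \<le> q k"
    and A: "multilinear_form m p A" "nonneg_form m A"
  shows "form_mixed_norm m q \<sigma> A \<le> form_norm m p A"
proof (rule dense_le)
  fix c assume c: "c < form_mixed_norm m q \<sigma> A"
  define a where "a j = norm (form_coeff m A j)" for j
  have a: "form_coeff m A j = of_real (a j)" for j
  proof -
    have "form_coeff m A j \<in> \<real>\<^sub>\<ge>\<^sub>0" using A by (simp add: nonneg_form_def)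
    then show ?thesis by (cases rule: nonneg_Reals_cases) (simp add: a_def)
  qed
  have p0: "\<forall>i\<in>{1..m}. 0 < p i" using p by (blast intro: exponent_pos)
  obtain N x where x: "test_tuple m p N x"
    and cx: "c \<le> ennreal (pairing N (map \<sigma> [1..<Suc m]) a x (\<lambda>_. 0))"
    using mixed_norm_attained[OF p \<sigma> q, of a 1 c "\<lambda>_. 0"] c
    by (auto simp: form_mixed_norm_def a_def[symmetric] simp del: upt_Suc) (auto simp: a_def)
  define z :: "nat \<Rightarrow> nat \<Rightarrow> 'k" where "z = (\<lambda>i\<in>{1..m}. \<lambda>n. of_real (x i n))"
  have set_eq: "set (map \<sigma> [1..<Suc m]) = {1..m}"
    using \<sigma> by (simp add: bij_betw_def atLeastLessThanSuc_atLeastAtMost del: upt_Suc)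
  have "A (\<lambda>i\<in>{1..m}. if i \<in> set (map \<sigma> [1..<Suc m]) then (\<lambda>n. of_real (x i n)) else unit_seq 0)
      = of_real (pairing N (map \<sigma> [1..<Suc m]) a x (\<lambda>_. 0))"
    using \<sigma> set_eq form_eq_pairing[OF A(1) p0 a x, of "map \<sigma> [1..<Suc m]" "\<lambda>_. 0"]
    by (simp add: distinct_map bij_betw_def atLeastLessThanSuc_atLeastAtMost del: upt_Suc)
  moreover have "(\<lambda>i\<in>{1..m}. if i \<in> set (map \<sigma> [1..<Suc m]) then (\<lambda>n. of_real (x i n)) else unit_seq 0) = z"
    unfolding set_eq z_def by (auto simp: restrict_def)
  ultimately have "A z = of_real (pairing N (map \<sigma> [1..<Suc m]) a x (\<lambda>_. 0))"
    by simp
  then have "c \<le> ennreal (norm (A z))"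
    using cx by (simp del: upt_Suc) (meson abs_ge_self ennreal_leI order_trans)
  also have "\<dots> \<le> form_norm m p A"
    unfolding form_norm_def
  proof (rule SUP_upper)
    have "z i \<in> X_space (p i)" "X_norm (p i) (z i) \<le> 1" if "i \<in> {1..m}" for i
      using that x p0 finite_support_in_X_space[of "p i" N "z i"]
      by (auto simp: z_def test_tuple_def X_norm_def)
    then show "z \<in> {x \<in> X_prod m p. \<forall>i\<in>{1..m}. X_norm (p i) (x i) \<le> 1}"
      by (auto simp: X_prod_def z_def)
  qed
  finally show "c \<le> form_norm m p A" .
qed

section \<open>Diagonal forms of length two\<close>

definition diagonal_index :: "nat set \<Rightarrow> nat \<Rightarrow> nat \<Rightarrow> nat" where
  "diagonal_index I n i = (if i \<in> I then n else 0)"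

text \<open>
  The product of the coordinates \<open>x\<^sub>i(0)\<close> over the slots outside \<open>I\<close>, times the diagonal form
  \<open>\<Prod>x\<^sub>i(0) + \<Prod>x\<^sub>i(1)\<close> on the slots in \<open>I\<close>.
\<close>

definition diagonal_form :: "nat \<Rightarrow> nat set \<Rightarrow> (nat \<Rightarrow> nat \<Rightarrow> 'k::real_normed_field) \<Rightarrow> 'k" where
  "diagonal_form m I x = (\<Sum>n<2. \<Prod>i\<in>{1..m}. x i (diagonal_index I n i))"

lemma multilinear_diagonal_form: "multilinear_form m p (diagonal_form m I)"
proof -
  have upd: "diagonal_form m I (x(i := u)) =
      (\<Sum>n<2. u (diagonal_index I n i) * (\<Prod>i'\<in>{1..m} - {i}. x i' (diagonal_index I n i')))"
    if "i \<in> {1..m}" for x u i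
    unfolding diagonal_form_def
  proof (rule sum.cong[OF refl])
    fix n
    have "(\<Prod>i'\<in>{1..m} - {i}. (x(i := u)) i' (diagonal_index I n i'))
        = (\<Prod>i'\<in>{1..m} - {i}. x i' (diagonal_index I n i'))"
      by (rule prod.cong) auto
    then show "(\<Prod>i'\<in>{1..m}. (x(i := u)) i' (diagonal_index I n i'))
        = u (diagonal_index I n i) * (\<Prod>i'\<in>{1..m} - {i}. x i' (diagonal_index I n i'))"
      using prod.remove[OF finite_atLeastAtMost that, of "\<lambda>i'. (x(i := u)) i' (diagonal_index I n i')"]
      by simp
  qed
  show ?thesis
    unfolding multilinear_form_def
    by (auto simp: upd distrib_right sum.distrib sum_distrib_left mult.assoc)
qed

lemma diagonal_form_coeff:
  "form_coeff m (diagonal_form m I) j =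
    of_real (\<Sum>n<2. \<Prod>i\<in>{1..m}. of_bool (diagonal_index I n i = j i))"
  unfolding form_coeff_def diagonal_form_def of_real_sum of_real_prod
  by (intro sum.cong prod.cong refl) (auto simp: unit_seq_def)

lemma diagonal_form_coeff_ge_1:
  assumes "n < 2" "\<And>i. i \<in> {1..m} \<Longrightarrow> j i = diagonal_index I n i"
  shows "1 \<le> norm (form_coeff m (diagonal_form m I) j :: 'k::real_normed_field)"
proof -
  have "1 = (\<Prod>i\<in>{1..m}. of_bool (diagonal_index I n i = j i) :: real)"
    using assms by simp
  also have "\<dots> \<le> (\<Sum>n<2. \<Prod>i\<in>{1..m}. of_bool (diagonal_index I n i = j i))"
    using assms(1) by (intro member_le_sum) (auto intro: prod_nonneg)
  finally show ?thesis
    unfolding diagonal_form_coeff norm_of_real by linarith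
qed

text \<open>
  Coordinates outside \<open>I\<close> are at most \<open>1\<close> in modulus, which leaves the sum of two products over \<open>I\<close> to
  Hoelder's inequality.
\<close>

lemma diagonal_form_norm_le:
  assumes p: "\<forall>i\<in>{1..m}. 1 \<le> p i" and I: "I \<subseteq> {1..m}"
  shows "form_norm m p (diagonal_form m I :: (nat \<Rightarrow> nat \<Rightarrow> 'k::real_normed_field) \<Rightarrow> 'k)
    \<le> ennreal (2 powr max 0 (1 - (\<Sum>i\<in>I. enn2real (1 / p i))))"
  unfolding form_norm_def
proof (rule SUP_least, rule ennreal_leI)
  fix x :: "nat \<Rightarrow> nat \<Rightarrow> 'k"
  assume "x \<in> {x \<in> X_prod m p. \<forall>i\<in>{1..m}. X_norm (p i) (x i) \<le> 1}"
  then have ball: "lq_norm (p i) (\<lambda>n. ennreal (norm (x i n))) \<le> 1" if "i \<in> {1..m}" for i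
    using that by (auto simp: X_norm_def)
  have x1: "norm (x i n) \<le> 1" if "i \<in> {1..m}" for i n
  proof -
    have "0 < p i" using p that by (blast intro: exponent_pos)
    then have "ennreal (norm (x i n)) \<le> lq_norm (p i) (\<lambda>n. ennreal (norm (x i n)))"
      by (rule term_le_lq_norm)
    also note ball[OF that]
    finally show ?thesis by simp
  qed
  have "norm (diagonal_form m I x) \<le> (\<Sum>n<2. \<Prod>i\<in>{1..m}. norm (x i (diagonal_index I n i)))"
    unfolding diagonal_form_def by (rule order_trans[OF norm_sum]) (simp add: prod_norm)
  also have "\<dots> \<le> (\<Sum>n<2. \<Prod>i\<in>I. norm (x i n))"
  proof (rule sum_mono)
    fix n
    have "(\<Prod>i\<in>{1..m}. norm (x i (diagonal_index I n i)))
        = (\<Prod>i\<in>{1..m} - I. norm (x i (diagonal_index I n i))) * (\<Prod>i\<in>I. norm (x i (diagonal_index I n i)))"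
      by (rule prod.subset_diff[OF I]) simp
    also have "(\<Prod>i\<in>I. norm (x i (diagonal_index I n i))) = (\<Prod>i\<in>I. norm (x i n))"
      by (rule prod.cong) (auto simp: diagonal_index_def)
    also have "(\<Prod>i\<in>{1..m} - I. norm (x i (diagonal_index I n i))) * (\<Prod>i\<in>I. norm (x i n))
        \<le> 1 * (\<Prod>i\<in>I. norm (x i n))"
      using x1 by (intro mult_right_mono prod_le_1 prod_nonneg) auto
    finally show "(\<Prod>i\<in>{1..m}. norm (x i (diagonal_index I n i))) \<le> (\<Prod>i\<in>I. norm (x i n))"
      by simp
  qed
  also have "\<dots> \<le> card {..<2::nat} powr max 0 (1 - (\<Sum>i\<in>I. enn2real (1 / p i)))"
  proof (rule sum_prod_le_card_powr)
    show "{..<2::nat} \<noteq> {}" by (metis empty_iff lessThan_iff pos2)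
    show "finite I" using I finite_subset by blast
    fix i assume i: "i \<in> I" "0 < enn2real (1 / p i)"
    then have im: "i \<in> {1..m}" and "1 \<le> p i" using p I by auto
    from this(2) show "(\<Sum>n<2. norm (x i n) powr (1 / enn2real (1 / p i))) \<le> 1"
    proof (cases rule: exponent_ge_1_cases)
      case 1
      then show ?thesis using i by simp
    next
      case (2 P)
      have "ennreal (\<Sum>n<2. norm (x i n) powr P) = (\<Sum>n<2. ennreal (norm (x i n) powr P))"
        by (simp add: sum_ennreal)
      also have "\<dots> \<le> (\<Sum>n. ennreal (norm (x i n) powr P))"
        by (rule sum_le_suminf) auto
      also have "\<dots> \<le> ennreal_powr 1 P"
        using ball[OF im] 2 by (simp add: lq_norm_le_iff)
      also have "\<dots> = 1" using ennreal_powr_ennreal[of 1 P] by simp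
      finally show ?thesis using 2 by simp
    qed
  qed (use x1 I in auto)
  finally show "norm (diagonal_form m I x) \<le> 2 powr max 0 (1 - (\<Sum>i\<in>I. enn2real (1 / p i)))"
    by simp
qed

lemma mixed_norm_append: "mixed_norm (l @ l') a j = mixed_norm l (mixed_norm l' a) j"
proof (induction l arbitrary: j)
  case (Cons iq l)
  then show ?case by (cases iq) (simp only: append_Cons mixed_norm.simps)
qed simp

text \<open>
  An \<open>\<ell>\<^sub>q\<close> norm dominates each of its terms, so the listed indices can be fixed at \<open>g\<close> one after another.
\<close>

lemma coeff_le_mixed_norm:
  assumes "\<And>i q. (i, q) \<in> set l \<Longrightarrow> 0 < q"
  shows "a (override_on j g (fst ` set l)) \<le> mixed_norm l a j"
  using assms
proof (induction l arbitrary: j)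
  case (Cons iq l)
  obtain i q where iq: "iq = (i, q)" by (cases iq)
  have "override_on j g (fst ` set (iq # l)) = override_on (j(i := g i)) g (fst ` set l)"
    by (auto simp: iq override_on_def)
  then have "a (override_on j g (fst ` set (iq # l))) = a (override_on (j(i := g i)) g (fst ` set l))"
    by (rule arg_cong)
  also have "\<dots> \<le> mixed_norm l a (j(i := g i))"
    using Cons by auto
  also have "\<dots> \<le> lq_norm q (\<lambda>n. mixed_norm l a (j(i := n)))"
    using Cons.prems[of i q] term_le_lq_norm[of q "\<lambda>n. mixed_norm l a (j(i := n))" "g i"]
    by (simp add: iq)
  finally show ?case by (simp add: iq)
qed simp

text \<open>
  The two entries \<open>1\<close> of the form lie on the diagonal of the slots \<open>\<sigma> k, \<dots>, \<sigma> m\<close>, so the inner norms see one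
  of them for each value of the index \<open>\<sigma> k\<close> and the \<open>\<ell>\<^sub>q\<close> norm with \<open>q = q k\<close> sees both. Length \<open>2\<close> already suffices:
  the inequality becomes \<open>2\<^bsup>1/q\<^esup> \<le> 2\<^bsup>max 0 (1-s)\<^esup>\<close>, which compares the exponents themselves.
\<close>

lemma delta_le_of_diagonal_form:
  assumes p: "\<forall>i\<in>{1..m}. 1 \<le> p i" and q: "\<forall>k\<in>{1..m}. 0 < q k"
    and \<sigma>: "bij_betw \<sigma> {1..m} {1..m}" and k: "k \<in> {1..m}"
    and le: "form_mixed_norm m q \<sigma> (diagonal_form m (\<sigma> ` {k..m}) :: (nat \<Rightarrow> nat \<Rightarrow> 'k::real_normed_field) \<Rightarrow> 'k)
      \<le> form_norm m p (diagonal_form m (\<sigma> ` {k..m}) :: (nat \<Rightarrow> nat \<Rightarrow> 'k) \<Rightarrow> 'k)"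
  shows "delta (\<lambda>i. p (\<sigma> i)) k m \<le> q k"
proof -
  define I where "I = \<sigma> ` {k..m}"
  define s where "s = (\<Sum>i=k..m. enn2real (1 / p (\<sigma> i)))"
  define a where "a j = ennreal (norm (form_coeff m (diagonal_form m I :: (nat \<Rightarrow> nat \<Rightarrow> 'k) \<Rightarrow> 'k) j))" for j
  let ?L = "\<lambda>k n. map (\<lambda>k. (\<sigma> k, q k)) [k..<n]"
  define f where "f = (\<lambda>n. mixed_norm (?L (Suc k) (Suc m)) a ((\<lambda>_. 0)(\<sigma> k := n)))"
  have \<sigma>_mem: "\<sigma> i \<in> {1..m}" if "i \<in> {1..m}" for i
    by (rule bij_betw_apply[OF \<sigma> that])
  have I: "I \<subseteq> {1..m}" unfolding I_def
    by (rule image_subsetI, rule \<sigma>_mem) (use k in auto)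
  have "inj_on \<sigma> {k..m}" 
    by (rule inj_on_subset[OF bij_betw_imp_inj_on[OF \<sigma>]]) (use k in auto)
  then have s_eq: "(\<Sum>i\<in>I. enn2real (1 / p i)) = s" by (simp add: I_def s_def sum.reindex)
  have f1: "1 \<le> f n" if "n < 2" for n
  proof -
    have set: "fst ` set (?L (Suc k) (Suc m)) = \<sigma> ` {Suc k..m}"
      by (simp add: image_image atLeastLessThanSuc_atLeastAtMost del: upt_Suc)
    have "{k..m} = insert k {Suc k..m}" using k by auto
    then have "I = insert (\<sigma> k) (\<sigma> ` {Suc k..m})" unfolding I_def by (simp only: image_insert)
    then have "override_on ((\<lambda>_. 0)(\<sigma> k := n)) (\<lambda>_. n) (\<sigma> ` {Suc k..m}) = diagonal_index I n"
      by (simp add: override_on_def diagonal_index_def fun_eq_iff)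
    moreover have "1 \<le> a (diagonal_index I n)"
      unfolding a_def using diagonal_form_coeff_ge_1[OF that, where ?'k = 'k]
      by (simp add: ennreal_1[symmetric] del: ennreal_1)
    moreover have "a (override_on ((\<lambda>_. 0)(\<sigma> k := n)) (\<lambda>_. n) (fst ` set (?L (Suc k) (Suc m)))) \<le> f n"
      unfolding f_def by (rule coeff_le_mixed_norm) (use q k in auto)
    ultimately show ?thesis unfolding set by simp
  qed
  have "[1..<Suc m] = [1..<k] @ [k..<Suc m]"
    using upt_add_eq_append[of 1 k "Suc m - k"] k by (simp del: upt_Suc)
  then have "form_mixed_norm m q \<sigma> (diagonal_form m I :: (nat \<Rightarrow> nat \<Rightarrow> 'k) \<Rightarrow> 'k)
      = mixed_norm (?L 1 k) (mixed_norm (?L k (Suc m)) a) (\<lambda>_. 0)"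
    using k by (simp add: form_mixed_norm_def a_def[symmetric] mixed_norm_append del: upt_Suc)
  moreover have "mixed_norm (?L k (Suc m)) a (\<lambda>_. 0) = lq_norm (q k) f"
    using k by (simp add: f_def upt_conv_Cons del: upt_Suc)
  \<comment> \<open>The outer norms, over slots where the form only looks at the coordinate \<open>0\<close>, are bounded below by freezing those indices at \<open>0\<close>.\<close>
  moreover have "mixed_norm (?L k (Suc m)) a (override_on (\<lambda>_. 0) (\<lambda>_. 0) (fst ` set (?L 1 k)))
      \<le> mixed_norm (?L 1 k) (mixed_norm (?L k (Suc m)) a) (\<lambda>_. 0)"
    by (rule coeff_le_mixed_norm) (use q k in auto)
  moreover have "override_on (\<lambda>_. 0) (\<lambda>_. 0) (fst ` set (?L 1 k)) = (\<lambda>_. 0::nat)"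
    by (auto simp: override_on_def)
  ultimately have "lq_norm (q k) f \<le> form_norm m p (diagonal_form m I :: (nat \<Rightarrow> nat \<Rightarrow> 'k) \<Rightarrow> 'k)"
    using le by (simp add: I_def)
  also have "\<dots> \<le> ennreal (2 powr max 0 (1 - s))"
    using diagonal_form_norm_le[OF p I, where ?'k = 'k] by (simp add: s_eq)
  finally have f_le: "lq_norm (q k) f \<le> ennreal (2 powr max 0 (1 - s))" .
  have "0 < q k" using q k by simp
  then show ?thesis
  proof (cases rule: ennreal_exponent_cases)
    case (2 Q)
    have "ennreal 2 = (\<Sum>n<2::nat. 1)" by simp
    also have "\<dots> \<le> (\<Sum>n<2. ennreal_powr (f n) Q)"
    proof (rule sum_mono)
      fix n :: nat assume "n \<in> {..<2}"
      then show "1 \<le> ennreal_powr (f n) Q"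
        using ennreal_powr_mono[of Q 1 "f n"] f1 2 ennreal_powr_ennreal[of 1 Q] by simp
    qed
    also have "\<dots> \<le> (\<Sum>n. ennreal_powr (f n) Q)"
      by (rule sum_le_suminf) auto
    also have "\<dots> \<le> ennreal (2 powr (max 0 (1 - s) * Q))"
      using f_le 2 by (simp add: lq_norm_le_iff powr_powr)
    finally have "2 powr 1 \<le> (2::real) powr (max 0 (1 - s) * Q)"
      by (simp del: ennreal_numeral)
    then have Q: "1 \<le> max 0 (1 - s) * Q" by (subst (asm) powr_le_cancel_iff) auto
    then have "s < 1" by (cases "s < 1") auto
    then have "1 / (1 - s) \<le> Q" using Q by (simp add: field_simps)
    moreover have "delta (\<lambda>i. p (\<sigma> i)) k m = ennreal (1 / (1 - s))"
      using \<open>s < 1\<close> p \<sigma>_mem k by (subst delta_eq) (auto simp: Let_def s_def)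
    ultimately show ?thesis by (simp add: 2 ennreal_leI)
  qed simp
qed

section \<open>The characterisation\<close>

lemma mixed_norm_inequality_iff:
  assumes "\<forall>i\<in>{1..m}. 1 \<le> p i" "\<forall>k\<in>{1..m}. 0 < q k" "bij_betw \<sigma> {1..m} {1..m}"
  shows "(\<forall>A :: (nat \<Rightarrow> nat \<Rightarrow> 'k::real_normed_field) \<Rightarrow> 'k.
            bounded_multilinear_form m p A \<and> nonneg_form m A \<longrightarrow>
            form_mixed_norm m q \<sigma> A \<le> form_norm m p A)
         \<longleftrightarrow> (\<forall>k\<in>{1..m}. delta (\<lambda>i. p (\<sigma> i)) k m \<le> q k)" (is "?L \<longleftrightarrow> ?R")
proof
  assume ?R
  then show ?L
    using form_mixed_norm_le_form_norm assms by (auto simp: bounded_multilinear_form_def)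
next
  assume L: ?L
  show ?R
  proof
    fix k assume k: "k \<in> {1..m}"
    let ?A = "diagonal_form m (\<sigma> ` {k..m}) :: (nat \<Rightarrow> nat \<Rightarrow> 'k) \<Rightarrow> 'k"
    have "\<sigma> ` {k..m} \<subseteq> {1..m}"
      by (rule image_subsetI, rule bij_betw_apply[OF assms(3)]) (use k in auto)
    then have "bounded_multilinear_form m p ?A"
      using diagonal_form_norm_le[OF assms(1), of "\<sigma> ` {k..m}", where ?'k = 'k]
      by (auto simp: bounded_multilinear_form_def multilinear_diagonal_form intro: le_less_trans)
    moreover have "nonneg_form m ?A"
      unfolding nonneg_form_def diagonal_form_coeff nonneg_Reals_of_real_iff
      by (auto intro!: sum_nonneg prod_nonneg)
    ultimately show "delta (\<lambda>i. p (\<sigma> i)) k m \<le> q k"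
      using L assms k by (intro delta_le_of_diagonal_form) auto
  qed
qed

theorem theorem1p3:
  fixes m :: nat and p q :: "nat \<Rightarrow> ennreal" and \<sigma> :: "nat \<Rightarrow> nat"
  assumes "m \<ge> 1"
    and "\<forall>i\<in>{1..m}. 1 \<le> p i"
    and "\<forall>k\<in>{1..m}. 0 < q k"
    and "bij_betw \<sigma> {1..m} {1..m}"
  shows "((\<forall>A :: (nat \<Rightarrow> nat \<Rightarrow> real) \<Rightarrow> real.
            bounded_multilinear_form m p A \<and> nonneg_form m A \<longrightarrow>
            form_mixed_norm m q \<sigma> A \<le> form_norm m p A)
         \<longleftrightarrow> (\<forall>k\<in>{1..m}. delta (\<lambda>i. p (\<sigma> i)) k m \<le> q k)) \<and>
         ((\<forall>A :: (nat \<Rightarrow> nat \<Rightarrow> complex) \<Rightarrow> complex.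
            bounded_multilinear_form m p A \<and> nonneg_form m A \<longrightarrow>
            form_mixed_norm m q \<sigma> A \<le> form_norm m p A)
         \<longleftrightarrow> (\<forall>k\<in>{1..m}. delta (\<lambda>i. p (\<sigma> i)) k m \<le> q k))"
  by (intro conjI mixed_norm_inequality_iff assms(2-4))

end
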